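(* Let $(X,\to,0,1)$ be an implicative-orthomodular algebra. For any deductive system $F$ of $X$, there exists a congruence on $X$, namely the relation $\equiv_F$ given by $$x\equiv_F y \iff \text{there exists } f\in X \text{ with } x\le_Q f,\ y\le_Q f,\ f\to x\in F,\ f\to y\in F,$$ such that $\{x\in X\mid x\equiv_F 1\}=F$. Conversely, given a congruence $\equiv$ on $X$, the set $\{x\in X\mid x\equiv 1\}$ is a deductive system of $X$.
   Context: A BE algebra is an algebra $(X,\to,1)$ of type $(2,0)$ such that for all $x,y,z\in X$: $x\to x=1$; $x\to 1=1$; $1\to x=x$; $x\to(y\to z)=y\to(x\to z)$. Put $x\le y$ iff $x\to y=1$. It is bounded if there is $0\in X$ with $0\le x$ for all $x\in X$; then $x^*:=x\to 0$. It is involutive if it is bounded and $x^{**}=x$ for all $x$. In an involutive BE algebra $(X,\to,0,1)$ define $x\Cap y:=((x^*\to y^* )\to y^* )^*$ and $x\le_Q y$ iff $x=x\Cap y$. An implicative-orthomodular algebra is an involutive BE algebra satisfying $x\Cap(y\to x)=x$ for all $x,y\in X$. A deductive system of $X$ is a subset $F\subseteq X$ with $1\in F$ and such that $x,\,x\to y\in F$ implies $y\in F$. A congruence on $X$ is an equivalence relation $\equiv$ on $X$ such that $x\equiv y$ and $u\equiv v$ imply $x\to u\equiv y\to v$. *)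

theory Defs
  imports Main
begin

locale be_algebra =
  fixes X :: "'a set"
    and imp :: "'a \<Rightarrow> 'a \<Rightarrow> 'a"  (infixr "\<rightarrow>" 60)
    and one :: 'a  ("\<one>")
  assumes imp_closed: "\<lbrakk>x \<in> X; y \<in> X\<rbrakk> \<Longrightarrow> x \<rightarrow> y \<in> X"
    and one_closed: "\<one> \<in> X"
    and imp_refl: "x \<in> X \<Longrightarrow> x \<rightarrow> x = \<one>"
    and imp_one: "x \<in> X \<Longrightarrow> x \<rightarrow> \<one> = \<one>"
    and one_imp: "x \<in> X \<Longrightarrow> \<one> \<rightarrow> x = x"
    and imp_exchange:
      "\<lbrakk>x \<in> X; y \<in> X; z \<in> X\<rbrakk> \<Longrightarrow> x \<rightarrow> (y \<rightarrow> z) = y \<rightarrow> (x \<rightarrow> z)"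
begin

definition le :: "'a \<Rightarrow> 'a \<Rightarrow> bool"  (infix "\<preceq>" 50)
  where "x \<preceq> y \<longleftrightarrow> x \<rightarrow> y = \<one>"

definition deductive_system :: "'a set \<Rightarrow> bool"
  where "deductive_system F \<longleftrightarrow>
    F \<subseteq> X \<and> \<one> \<in> F \<and> (\<forall>x\<in>X. \<forall>y\<in>X. x \<in> F \<longrightarrow> x \<rightarrow> y \<in> F \<longrightarrow> y \<in> F)"

definition congruence :: "('a \<times> 'a) set \<Rightarrow> bool"
  where "congruence R \<longleftrightarrow> equiv X R \<and>
    (\<forall>x y u v. (x, y) \<in> R \<longrightarrow> (u, v) \<in> R \<longrightarrow> (x \<rightarrow> u, y \<rightarrow> v) \<in> R)"

end

text \<open>The least element is a parameter, as in the signature \<open>(X, \<rightarrow>, 0, 1)\<close>. In the involutive case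
  it is unique, since a second one \<open>0'\<close> satisfies \<open>0' = (0' \<rightarrow> 0) \<rightarrow> 0 = 1 \<rightarrow> 0 = 0\<close>.\<close>

locale bounded_be_algebra = be_algebra +
  fixes zero :: 'a  ("\<zero>")
  assumes zero_closed: "\<zero> \<in> X"
    and zero_le: "x \<in> X \<Longrightarrow> \<zero> \<preceq> x"
begin

definition compl :: "'a \<Rightarrow> 'a"  ("_\<^sup>*" [1000] 999)
  where "x\<^sup>* = x \<rightarrow> \<zero>"

end

locale involutive_be_algebra = bounded_be_algebra +
  assumes compl_compl: "x \<in> X \<Longrightarrow> (x\<^sup>*)\<^sup>* = x"
begin

definition Cap :: "'a \<Rightarrow> 'a \<Rightarrow> 'a"  (infixl "\<Zcap>" 70)
  where "x \<Zcap> y = ((x\<^sup>* \<rightarrow> y\<^sup>*) \<rightarrow> y\<^sup>*)\<^sup>*"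

definition leQ :: "'a \<Rightarrow> 'a \<Rightarrow> bool"  (infix "\<preceq>\<^sub>Q" 50)
  where "x \<preceq>\<^sub>Q y \<longleftrightarrow> x = x \<Zcap> y"

text \<open>The relation \<open>\<equiv>\<^sub>F\<close> induced by a deductive system \<open>F\<close>, as a set of pairs in \<open>X \<times> X\<close>.\<close>

definition ds_rel :: "'a set \<Rightarrow> ('a \<times> 'a) set"
  where "ds_rel F = {(x, y). x \<in> X \<and> y \<in> X \<and>
    (\<exists>f\<in>X. x \<preceq>\<^sub>Q f \<and> y \<preceq>\<^sub>Q f \<and> f \<rightarrow> x \<in> F \<and> f \<rightarrow> y \<in> F)}"

end

locale implicative_orthomodular_algebra = involutive_be_algebra +
  assumes Cap_imp: "\<lbrakk>x \<in> X; y \<in> X\<rbrakk> \<Longrightarrow> x \<Zcap> (y \<rightarrow> x) = x"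

end

theory Submission
  imports Defs
begin

text \<open>Two elements are related by \<open>\<equiv>\<^sub>F\<close> iff they can be made equal by prefixing premises from
  \<open>F\<close>: \<open>u \<rightarrow> x = v \<rightarrow> y\<close> for some \<open>u, v \<in> F\<close> (\<open>ds_rel_iff\<close>). In this form most of the theorem is
  formal. Finitely many premises from \<open>F\<close> can be fused into a single one (\<open>fuse\<close>), whence
  transitivity; the exchange law lets premises pass through \<open>z \<rightarrow> _\<close>, whence compatibility in the
  second argument; and \<open>u \<rightarrow> x = 1\<close> with \<open>u \<in> F\<close> forces \<open>x \<in> F\<close>, whence the class of \<open>1\<close>.

  Orthomodularity enters through the order. The axiom says that \<open>x \<le>\<^sub>Q y \<rightarrow> x\<close> always, and its
  consequence is that \<open>x \<le>\<^sub>Q f\<close> holds precisely when \<open>f\<close> has the form \<open>u \<rightarrow> x\<close>; moreover \<open>u\<close> can then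
  be chosen to be \<open>f \<rightarrow> x\<close>, so that \<open>f = (f \<rightarrow> x) \<rightarrow> x\<close> (\<open>leQ_residual\<close>). This translates the
  definition of \<open>\<equiv>\<^sub>F\<close> into the description above. For the first argument, the definition of
  \<open>x \<le>\<^sub>Q f\<close> recovers \<open>x \<rightarrow> z\<close> from \<open>f \<rightarrow> z\<close> by the premise \<open>f \<rightarrow> x\<close> (\<open>leQ_imp_left\<close>), so
  a common upper bound \<open>f\<close> of \<open>x\<close> and \<open>y\<close> relates \<open>x \<rightarrow> z\<close> to \<open>y \<rightarrow> z\<close> through \<open>f \<rightarrow> z\<close>.

  The converse is modus ponens in the quotient: if \<open>x \<equiv> 1\<close> then \<open>x \<rightarrow> y \<equiv> 1 \<rightarrow> y = y\<close>.\<close>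

context be_algebra
begin

lemma deductive_system_subset: "deductive_system F \<Longrightarrow> u \<in> F \<Longrightarrow> u \<in> X"
  by (auto simp: deductive_system_def)

lemma deductive_system_one: "deductive_system F \<Longrightarrow> \<one> \<in> F"
  by (simp add: deductive_system_def)

lemma deductive_system_mp:
  "deductive_system F \<Longrightarrow> u \<in> F \<Longrightarrow> u \<rightarrow> x \<in> F \<Longrightarrow> x \<in> X \<Longrightarrow> x \<in> F"
  by (auto simp: deductive_system_def)

lemma imp_imp_self: "u \<in> X \<Longrightarrow> x \<in> X \<Longrightarrow> u \<rightarrow> ((u \<rightarrow> x) \<rightarrow> x) = \<one>"
  by (simp add: imp_exchange[of u "u \<rightarrow> x"] imp_closed imp_refl)

lemma congruence_class_one:
  assumes "congruence R"
  shows "deductive_system {x \<in> X. (x, \<one>) \<in> R}"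
proof -
  have eq: "equiv X R"
    and cong: "\<And>x y u v. (x, y) \<in> R \<Longrightarrow> (u, v) \<in> R \<Longrightarrow> (x \<rightarrow> u, y \<rightarrow> v) \<in> R"
    using assms by (auto simp: congruence_def)
  have refl: "\<And>x. x \<in> X \<Longrightarrow> (x, x) \<in> R"
    using eq by (auto simp: equiv_def refl_on_def)
  have sym: "\<And>x y. (x, y) \<in> R \<Longrightarrow> (y, x) \<in> R"
    and trans: "\<And>x y z. (x, y) \<in> R \<Longrightarrow> (y, z) \<in> R \<Longrightarrow> (x, z) \<in> R"
    using eq by (auto simp: equiv_def dest: symD transD)
  have "(y, \<one>) \<in> R" if "y \<in> X" "(x, \<one>) \<in> R" "(x \<rightarrow> y, \<one>) \<in> R" for x y
  proof -
    have "(x \<rightarrow> y, y) \<in> R"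
      using cong[OF that(2) refl[OF that(1)]] that(1) by (simp add: one_imp)
    then show ?thesis
      using sym trans that(3) by blast
  qed
  then show ?thesis
    unfolding deductive_system_def using one_closed refl by blast
qed

end

context involutive_be_algebra
begin

lemma compl_closed: "x \<in> X \<Longrightarrow> x\<^sup>* \<in> X"
  by (simp add: compl_def imp_closed zero_closed)

lemma imp_compl_commute: "x \<in> X \<Longrightarrow> y \<in> X \<Longrightarrow> x \<rightarrow> y\<^sup>* = y \<rightarrow> x\<^sup>*"
  by (simp add: compl_def imp_exchange zero_closed)

lemma contrapositive: "x \<in> X \<Longrightarrow> y \<in> X \<Longrightarrow> y\<^sup>* \<rightarrow> x\<^sup>* = x \<rightarrow> y"
  using imp_compl_commute[of x "y\<^sup>*"] by (simp add: compl_closed compl_compl)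

text \<open>The element \<open>(u \<rightarrow> v\<^sup>*)\<^sup>*\<close> is the fusion (monoidal conjunction) of \<open>u\<close> and \<open>v\<close>.\<close>

lemma fusion_imp:
  assumes "u \<in> X" "v \<in> X" "x \<in> X"
  shows "(u \<rightarrow> v\<^sup>*)\<^sup>* \<rightarrow> x = u \<rightarrow> (v \<rightarrow> x)"
proof -
  have "(u \<rightarrow> v\<^sup>*)\<^sup>* \<rightarrow> x = x\<^sup>* \<rightarrow> (u \<rightarrow> v\<^sup>*)"
    using contrapositive[of "(u \<rightarrow> v\<^sup>*)\<^sup>*" x] assms
    by (simp add: imp_closed compl_closed compl_compl)
  also have "\<dots> = u \<rightarrow> (x\<^sup>* \<rightarrow> v\<^sup>*)"
    using assms by (simp add: imp_exchange compl_closed)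
  finally show ?thesis
    using assms by (simp add: contrapositive)
qed

text \<open>The premise \<open>w\<close> is the fusion of \<open>u\<close> and \<open>v\<close>; it lies in \<open>F\<close> by two detachments, because
  \<open>u \<rightarrow> (v \<rightarrow> w) = w \<rightarrow> w = 1\<close>.\<close>

lemma fuse:
  assumes F: "deductive_system F" and u: "u \<in> F" and v: "v \<in> F"
  obtains w where "w \<in> F" "\<And>x. x \<in> X \<Longrightarrow> w \<rightarrow> x = u \<rightarrow> (v \<rightarrow> x)"
proof -
  have X: "u \<in> X" "v \<in> X"
    using F u v by (auto intro: deductive_system_subset)
  define w where "w = (u \<rightarrow> v\<^sup>*)\<^sup>*"
  have wX: "w \<in> X"
    using X by (simp add: w_def imp_closed compl_closed)
  have fusion: "w \<rightarrow> x = u \<rightarrow> (v \<rightarrow> x)" if "x \<in> X" for x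
    using X that by (simp add: w_def fusion_imp)
  have "u \<rightarrow> (v \<rightarrow> w) = \<one>"
    using fusion[OF wX] wX by (simp add: imp_refl)
  then have "u \<rightarrow> (v \<rightarrow> w) \<in> F"
    using F by (simp only: deductive_system_one)
  then have "v \<rightarrow> w \<in> F"
    by (rule deductive_system_mp[OF F u]) (simp add: X wX imp_closed)
  then have "w \<in> F"
    by (rule deductive_system_mp[OF F v]) (rule wX)
  with fusion show ?thesis
    by (blast intro: that)
qed

lemma leQ_compl:
  assumes "x \<in> X" "f \<in> X" "x \<preceq>\<^sub>Q f"
  shows "(f \<rightarrow> x) \<rightarrow> f\<^sup>* = x\<^sup>*"
proof -
  have "x\<^sup>* = (((x\<^sup>* \<rightarrow> f\<^sup>*) \<rightarrow> f\<^sup>*)\<^sup>*)\<^sup>*"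
    using assms(3) by (simp add: leQ_def Cap_def)
  then show ?thesis
    using assms(1,2) by (simp add: contrapositive compl_compl imp_closed compl_closed)
qed

text \<open>Contraposition turns \<open>leQ_compl\<close> into a statement about arbitrary conclusions \<open>z\<close>.\<close>

lemma leQ_imp_left:
  assumes "x \<in> X" "f \<in> X" "z \<in> X" "x \<preceq>\<^sub>Q f"
  shows "(f \<rightarrow> x) \<rightarrow> (f \<rightarrow> z) = x \<rightarrow> z"
proof -
  have "(f \<rightarrow> x) \<rightarrow> (f \<rightarrow> z) = (f \<rightarrow> x) \<rightarrow> (z\<^sup>* \<rightarrow> f\<^sup>*)"
    using assms by (simp add: contrapositive)
  also have "\<dots> = z\<^sup>* \<rightarrow> ((f \<rightarrow> x) \<rightarrow> f\<^sup>*)"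
    using assms by (simp add: imp_exchange imp_closed compl_closed)
  finally show ?thesis
    using assms by (simp add: leQ_compl contrapositive)
qed

end

context implicative_orthomodular_algebra
begin

lemma leQ_imp: "x \<in> X \<Longrightarrow> y \<in> X \<Longrightarrow> x \<preceq>\<^sub>Q y \<rightarrow> x"
  by (simp add: leQ_def Cap_imp)

text \<open>The point is that \<open>\<le>\<^sub>Q\<close> is reversed by the complement: \<open>x \<le>\<^sub>Q f\<close> exhibits \<open>x\<^sup>*\<close> as an
  implication with conclusion \<open>f\<^sup>*\<close>, so the axiom yields \<open>f\<^sup>* \<le>\<^sub>Q x\<^sup>*\<close>, and unfolding this gives
  the equation.\<close>

lemma leQ_residual:
  assumes "x \<in> X" "f \<in> X" "x \<preceq>\<^sub>Q f"
  shows "(f \<rightarrow> x) \<rightarrow> x = f"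
proof -
  have "f\<^sup>* \<preceq>\<^sub>Q x\<^sup>*"
    using leQ_imp[of "f\<^sup>*" "f \<rightarrow> x"] leQ_compl[OF assms] assms(1,2)
    by (simp add: imp_closed compl_closed)
  from leQ_compl[OF _ _ this] show ?thesis
    using assms(1,2) by (simp add: contrapositive compl_compl compl_closed)
qed

text \<open>A common value \<open>u \<rightarrow> x = v \<rightarrow> y\<close> serves as the upper bound \<open>f\<close>, since
  \<open>u \<rightarrow> ((u \<rightarrow> x) \<rightarrow> x) = 1\<close>; conversely, an upper bound \<open>f\<close> is the common value for the premises
  \<open>f \<rightarrow> x\<close> and \<open>f \<rightarrow> y\<close>.\<close>

lemma ds_rel_iff:
  assumes F: "deductive_system F"
  shows "(x, y) \<in> ds_rel F \<longleftrightarrow> x \<in> X \<and> y \<in> X \<and> (\<exists>u\<in>F. \<exists>v\<in>F. u \<rightarrow> x = v \<rightarrow> y)"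
proof
  assume "(x, y) \<in> ds_rel F"
  then obtain f where f: "x \<in> X" "y \<in> X" "f \<in> X" "x \<preceq>\<^sub>Q f" "y \<preceq>\<^sub>Q f" "f \<rightarrow> x \<in> F" "f \<rightarrow> y \<in> F"
    by (auto simp: ds_rel_def)
  then have "(f \<rightarrow> x) \<rightarrow> x = (f \<rightarrow> y) \<rightarrow> y"
    by (simp add: leQ_residual)
  with f show "x \<in> X \<and> y \<in> X \<and> (\<exists>u\<in>F. \<exists>v\<in>F. u \<rightarrow> x = v \<rightarrow> y)"
    by blast
next
  have bound: "x \<preceq>\<^sub>Q u \<rightarrow> x \<and> (u \<rightarrow> x) \<rightarrow> x \<in> F" if "x \<in> X" "u \<in> F" for x u
  proof -
    have u: "u \<in> X"
      using F that(2) by (rule deductive_system_subset)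
    have "u \<rightarrow> ((u \<rightarrow> x) \<rightarrow> x) \<in> F"
      using F u that(1) by (simp add: imp_imp_self deductive_system_one)
    then show ?thesis
      using F u that by (blast intro: deductive_system_mp imp_closed leQ_imp)
  qed
  assume "x \<in> X \<and> y \<in> X \<and> (\<exists>u\<in>F. \<exists>v\<in>F. u \<rightarrow> x = v \<rightarrow> y)"
  then obtain u v where uv: "x \<in> X" "y \<in> X" "u \<in> F" "v \<in> F" "u \<rightarrow> x = v \<rightarrow> y"
    by blast
  moreover have "u \<rightarrow> x \<in> X"
    using F uv by (blast intro: deductive_system_subset imp_closed)
  ultimately show "(x, y) \<in> ds_rel F"
    using bound[of x u] bound[of y v] by (auto simp: ds_rel_def)
qed

lemma ds_rel_trans:
  assumes F: "deductive_system F" and xy: "(x, y) \<in> ds_rel F" and yz: "(y, z) \<in> ds_rel F"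
  shows "(x, z) \<in> ds_rel F"
proof -
  obtain u v where uv: "x \<in> X" "y \<in> X" "u \<in> F" "v \<in> F" "u \<rightarrow> x = v \<rightarrow> y"
    using xy ds_rel_iff[OF F] by blast
  obtain s t where st: "z \<in> X" "s \<in> F" "t \<in> F" "s \<rightarrow> y = t \<rightarrow> z"
    using yz ds_rel_iff[OF F] by blast
  have X: "u \<in> X" "v \<in> X" "s \<in> X" "t \<in> X"
    using F uv st by (auto intro: deductive_system_subset)
  have common: "s \<rightarrow> (u \<rightarrow> x) = v \<rightarrow> (t \<rightarrow> z)"
    using uv st X imp_exchange[of s v y] by simp
  obtain p where p: "p \<in> F" "\<And>x. x \<in> X \<Longrightarrow> p \<rightarrow> x = s \<rightarrow> (u \<rightarrow> x)"
    using fuse[OF F] uv(3) st(2) by blast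
  obtain q where q: "q \<in> F" "\<And>x. x \<in> X \<Longrightarrow> q \<rightarrow> x = v \<rightarrow> (t \<rightarrow> x)"
    using fuse[OF F] uv(4) st(3) by blast
  have "p \<rightarrow> x = q \<rightarrow> z"
    using common p q uv st by simp
  then show ?thesis
    using p q uv st ds_rel_iff[OF F] by blast
qed

lemma ds_rel_imp_right:
  assumes F: "deductive_system F" and xy: "(x, y) \<in> ds_rel F" and z: "z \<in> X"
  shows "(z \<rightarrow> x, z \<rightarrow> y) \<in> ds_rel F"
proof -
  obtain u v where uv: "x \<in> X" "y \<in> X" "u \<in> F" "v \<in> F" "u \<rightarrow> x = v \<rightarrow> y"
    using xy ds_rel_iff[OF F] by blast
  have "u \<in> X" "v \<in> X"
    using F uv by (auto intro: deductive_system_subset)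
  then have "u \<rightarrow> (z \<rightarrow> x) = v \<rightarrow> (z \<rightarrow> y)"
    using uv z imp_exchange[of u z x] imp_exchange[of v z y] by simp
  then show ?thesis
    using uv z ds_rel_iff[OF F] by (blast intro: imp_closed)
qed

text \<open>If \<open>f\<close> bounds \<open>x\<close> and \<open>y\<close>, then \<open>x \<rightarrow> z\<close> and \<open>y \<rightarrow> z\<close> arise from \<open>f \<rightarrow> z\<close> by the premises
  \<open>f \<rightarrow> x\<close> and \<open>f \<rightarrow> y\<close>; adding to each the premise of the other makes them equal.\<close>

lemma ds_rel_imp_left:
  assumes F: "deductive_system F" and xy: "(x, y) \<in> ds_rel F" and z: "z \<in> X"
  shows "(x \<rightarrow> z, y \<rightarrow> z) \<in> ds_rel F"
proof -
  obtain f where f: "x \<in> X" "y \<in> X" "f \<in> X" "x \<preceq>\<^sub>Q f" "y \<preceq>\<^sub>Q f" "f \<rightarrow> x \<in> F" "f \<rightarrow> y \<in> F"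
    using xy by (auto simp: ds_rel_def)
  have "(f \<rightarrow> y) \<rightarrow> ((f \<rightarrow> x) \<rightarrow> (f \<rightarrow> z)) = (f \<rightarrow> x) \<rightarrow> ((f \<rightarrow> y) \<rightarrow> (f \<rightarrow> z))"
    using f z by (intro imp_exchange imp_closed)
  then have "(f \<rightarrow> y) \<rightarrow> (x \<rightarrow> z) = (f \<rightarrow> x) \<rightarrow> (y \<rightarrow> z)"
    using f z by (simp add: leQ_imp_left)
  then show ?thesis
    using f z ds_rel_iff[OF F] by (blast intro: imp_closed)
qed

lemma ds_rel_congruence:
  assumes F: "deductive_system F"
  shows "congruence (ds_rel F)"
proof -
  have sub: "ds_rel F \<subseteq> X \<times> X"
    by (auto simp: ds_rel_def)
  have "refl_on X (ds_rel F)"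
    using deductive_system_one[OF F] by (auto simp: refl_on_def ds_rel_iff[OF F])
  moreover have "sym (ds_rel F)"
    by (auto simp: sym_def ds_rel_def)
  moreover have "trans (ds_rel F)"
    using ds_rel_trans[OF F] by (rule transI)
  ultimately have "equiv X (ds_rel F)"
    using sub by (simp add: equiv_def)
  moreover have "(x \<rightarrow> u, y \<rightarrow> v) \<in> ds_rel F" if "(x, y) \<in> ds_rel F" "(u, v) \<in> ds_rel F" for x y u v
  proof (rule ds_rel_trans[OF F])
    show "(x \<rightarrow> u, y \<rightarrow> u) \<in> ds_rel F"
      using ds_rel_imp_left[OF F that(1)] that(2) sub by blast
    show "(y \<rightarrow> u, y \<rightarrow> v) \<in> ds_rel F"
      using ds_rel_imp_right[OF F that(2)] that(1) sub by blast
  qed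
  ultimately show ?thesis
    by (simp add: congruence_def)
qed

lemma ds_rel_class_one:
  assumes F: "deductive_system F"
  shows "{x \<in> X. (x, \<one>) \<in> ds_rel F} = F"
proof (intro equalityI subsetI)
  fix x
  assume "x \<in> {x \<in> X. (x, \<one>) \<in> ds_rel F}"
  then obtain u v where uv: "x \<in> X" "u \<in> F" "v \<in> F" "u \<rightarrow> x = v \<rightarrow> \<one>"
    using ds_rel_iff[OF F] by blast
  then have "u \<rightarrow> x \<in> F"
    using F by (simp add: imp_one deductive_system_subset deductive_system_one)
  then show "x \<in> F"
    using F uv by (blast intro: deductive_system_mp)
next
  fix x
  assume x: "x \<in> F"
  then have xX: "x \<in> X"
    using F by (blast intro: deductive_system_subset)
  then have "x \<rightarrow> x = \<one> \<rightarrow> \<one>"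
    by (simp add: imp_refl one_closed)
  then show "x \<in> {x \<in> X. (x, \<one>) \<in> ds_rel F}"
    using x xX one_closed deductive_system_one[OF F] ds_rel_iff[OF F] by blast
qed

end

theorem theorem5p7:
  fixes X :: "'a set" and imp :: "'a \<Rightarrow> 'a \<Rightarrow> 'a" and one zero :: 'a
  assumes "implicative_orthomodular_algebra X imp one zero"
  shows "(\<forall>F. be_algebra.deductive_system X imp one F \<longrightarrow>
            be_algebra.congruence X imp (involutive_be_algebra.ds_rel X imp zero F) \<and>
            {x \<in> X. (x, one) \<in> involutive_be_algebra.ds_rel X imp zero F} = F) \<and>
         (\<forall>R. be_algebra.congruence X imp R \<longrightarrow>
            be_algebra.deductive_system X imp one {x \<in> X. (x, one) \<in> R})"
proof -
  interpret implicative_orthomodular_algebra X imp one zero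
    by (rule assms)
  show ?thesis
    using ds_rel_congruence ds_rel_class_one congruence_class_one by blast
qed

end
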